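(* There is no bribeproof mechanism for the path auction problem on general networks and for three-values domains. That is: for all reals $L<M<H$ there is a network such that, for the domain $\Theta_i=\{L,M,H\}$ for every agent $i$, no mechanism $(A,p)$ whose algorithm $A$ always selects a minimum-cost $s$–$t$ path is bribeproof.
   Context: Path auction: a network is a finite graph with two distinguished nodes $s,t$ joined by at least one path; each edge is owned by a distinct agent, $N=\{1,\dots,n\}$, $n\ge2$. A feasible allocation is the $0/1$ indicator vector of the edges of a (simple) $s$–$t$ path: each agent on the selected path gets one unit of work, all others get zero. Agent $i$ has private type $\theta_i\in\Theta_i$, the cost of her edge. $\Theta=\Theta_1\times\cdots\times\Theta_n$. A mechanism is a pair $(A,p)$ where $A:\Theta\to\mathcal{A}$ maps reported types to a feasible allocation and $p:\Theta\to\mathbb{R}^n$ gives payments to agents; the algorithm selects a path minimizing $\sum_i A_i(\theta)\theta_i$ for every $\theta$ (ties broken arbitrarily). $(A,p)$ is bribeproof if for all $\theta\in\Theta$, all $i,j\in N$ and all $\hat\theta_i\in\Theta_i$, with $\hat\theta$ denoting $\theta$ with its $i$-th entry replaced by $\hat\theta_i$: if $i\neq j$, $p_i(\theta)-A_i(\theta)\theta_i+p_j(\theta)-A_j(\theta)\theta_j\ge p_i(\hat\theta)-A_i(\hat\theta)\theta_i+p_j(\hat\theta)-A_j(\hat\theta)\theta_j$; and, for $i=j$, $p_i(\theta)-A_i(\theta)\theta_i\ge p_i(\hat\theta)-A_i(\hat\theta)\theta_i$. *)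

theory Defs
  imports Complex_Main "HOL-Library.FuncSet"
begin

(* Finite simple undirected graphs in which edge i, a two-element set of vertices,
   is the edge owned by agent i. Only agents 1, ..., num_agents count; the values of
   edge on other indices are irrelevant. *)

record 'v network =
  num_agents :: nat
  verts :: "'v set"
  edge :: "nat \<Rightarrow> 'v set"
  source :: 'v
  sink :: 'v

definition agents :: "'v network \<Rightarrow> nat set" where
  "agents G = {1..num_agents G}"

definition st_path :: "'v network \<Rightarrow> 'v list \<Rightarrow> bool" where
  "st_path G xs \<longleftrightarrow>
     xs \<noteq> [] \<and> distinct xs \<and> set xs \<subseteq> verts G \<and> hd xs = source G \<and> last xs = sink G \<and>
     (\<forall>k. Suc k < length xs \<longrightarrow> {xs ! k, xs ! Suc k} \<in> edge G ` agents G)"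

definition path_edges :: "'v list \<Rightarrow> 'v set set" where
  "path_edges xs = {{xs ! k, xs ! Suc k} | k. Suc k < length xs}"

(* Injectivity of edge on the agents says both that distinct edges have distinct
   owners and that there are no parallel edges. *)

definition is_network :: "'v network \<Rightarrow> bool" where
  "is_network G \<longleftrightarrow>
     num_agents G \<ge> 2 \<and> finite (verts G) \<and>
     (\<forall>i\<in>agents G. edge G i \<subseteq> verts G \<and> card (edge G i) = 2) \<and>
     inj_on (edge G) (agents G) \<and>
     source G \<in> verts G \<and> sink G \<in> verts G \<and> source G \<noteq> sink G \<and>
     (\<exists>xs. st_path G xs)"

definition path_allocation :: "'v network \<Rightarrow> 'v list \<Rightarrow> nat \<Rightarrow> real" where
  "path_allocation G xs = (\<lambda>i\<in>agents G. if edge G i \<in> path_edges xs then 1 else 0)"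

definition feasible :: "'v network \<Rightarrow> (nat \<Rightarrow> real) set" where
  "feasible G = {path_allocation G xs | xs. st_path G xs}"

definition total_cost :: "nat set \<Rightarrow> (nat \<Rightarrow> real) \<Rightarrow> (nat \<Rightarrow> real) \<Rightarrow> real" where
  "total_cost N a \<theta> = (\<Sum>i\<in>N. a i * \<theta> i)"

definition minimizes_cost ::
    "'v network \<Rightarrow> (nat \<Rightarrow> real set) \<Rightarrow> ((nat \<Rightarrow> real) \<Rightarrow> nat \<Rightarrow> real) \<Rightarrow> bool" where
  "minimizes_cost G D A \<longleftrightarrow>
     (\<forall>\<theta>\<in>Pi\<^sub>E (agents G) D. \<forall>a\<in>feasible G.
        total_cost (agents G) (A \<theta>) \<theta> \<le> total_cost (agents G) a \<theta>)"

(* utility A p r \<theta> i is the utility of agent i when the reports are r and the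
   true types are \<theta>. *)

definition utility ::
    "('r \<Rightarrow> nat \<Rightarrow> real) \<Rightarrow> ('r \<Rightarrow> nat \<Rightarrow> real) \<Rightarrow> 'r \<Rightarrow> (nat \<Rightarrow> real) \<Rightarrow> nat \<Rightarrow> real" where
  "utility A p r \<theta> i = p r i - A r i * \<theta> i"

definition bribeproof ::
    "nat set \<Rightarrow> (nat \<Rightarrow> real set) \<Rightarrow>
     ((nat \<Rightarrow> real) \<Rightarrow> nat \<Rightarrow> real) \<Rightarrow> ((nat \<Rightarrow> real) \<Rightarrow> nat \<Rightarrow> real) \<Rightarrow> bool" where
  "bribeproof N D A p \<longleftrightarrow>
     (\<forall>\<theta>\<in>Pi\<^sub>E N D. \<forall>i\<in>N. \<forall>j\<in>N. \<forall>x\<in>D i.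
        (i \<noteq> j \<longrightarrow>
           utility A p \<theta> \<theta> i + utility A p \<theta> \<theta> j
             \<ge> utility A p (\<theta>(i := x)) \<theta> i + utility A p (\<theta>(i := x)) \<theta> j) \<and>
        (i = j \<longrightarrow>
           utility A p \<theta> \<theta> i \<ge> utility A p (\<theta>(i := x)) \<theta> i))"

end

theory Submission imports Defs begin

text \<open>
  On a cycle consisting of two disjoint source-sink paths of equal length, bribeproofness forces
  the payments to depend only on which path is selected. Let the gap of an agent be her payment
  when her path is selected minus her payment when it is not. Ties in which all agents report
  \<open>M\<close> except for one \<open>H\<close> on each path show that at most one agent per path has a gap below \<open>M\<close>,
  so with three edges per path both paths have two agents with gap at least \<open>M\<close>. Now consider a
  tie in which all agents report \<open>M\<close> except for one of these two agents, \<open>j\<close>, on each path, who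
  reports \<open>L\<close>. On the path that loses the tie, the other agent \<open>i\<close> could win by reporting \<open>L\<close>.
  That this bribe is not profitable for the pair \<open>i\<close>, \<open>j\<close> bounds the sum of their gaps by
  \<open>L + M\<close>, which is less than \<open>2 * M\<close>.
\<close>

text \<open>The graph enters only as a split of the agents into two equally large paths. Indexing
  them by \<open>bool\<close> makes \<open>\<not> b\<close> the rival of \<open>b\<close>, so each
  argument is given once for both paths.\<close>

locale two_path_mechanism =
  fixes N :: "'a set" and path :: "bool \<Rightarrow> 'a set" and L M H :: real
    and A p :: "('a \<Rightarrow> real) \<Rightarrow> 'a \<Rightarrow> real" and sel :: "('a \<Rightarrow> real) \<Rightarrow> bool"
    and \<Theta> :: "('a \<Rightarrow> real) set"
  defines "\<Theta> \<equiv> Pi\<^sub>E N (\<lambda>_. {L, M, H})"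
  assumes LM: "L < M" and MH: "M < H"
    and N_eq: "N = path True \<union> path False"
    and finite_path: "finite (path b)"
    and disjoint: "path True \<inter> path False = {}"
    and card_path: "card (path True) = card (path False)"
    and alloc: "\<theta> \<in> \<Theta> \<Longrightarrow> i \<in> N \<Longrightarrow> A \<theta> i = of_bool (i \<in> path (sel \<theta>))"
    and sel_min: "\<theta> \<in> \<Theta> \<Longrightarrow> sum \<theta> (path (sel \<theta>)) \<le> sum \<theta> (path b)"
    and truthful: "\<theta> \<in> \<Theta> \<Longrightarrow> i \<in> N \<Longrightarrow> x \<in> {L, M, H} \<Longrightarrow>
      p \<theta> i - A \<theta> i * \<theta> i \<ge> p (\<theta>(i := x)) i - A (\<theta>(i := x)) i * \<theta> i"
    and unbribable: "\<theta> \<in> \<Theta> \<Longrightarrow> i \<in> N \<Longrightarrow> j \<in> N \<Longrightarrow> i \<noteq> j \<Longrightarrow> x \<in> {L, M, H} \<Longrightarrow>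
      p \<theta> i - A \<theta> i * \<theta> i + (p \<theta> j - A \<theta> j * \<theta> j)
        \<ge> p (\<theta>(i := x)) i - A (\<theta>(i := x)) i * \<theta> i + (p (\<theta>(i := x)) j - A (\<theta>(i := x)) j * \<theta> j)"
begin

lemma path_subset: "i \<in> path b \<Longrightarrow> i \<in> N"
  by (cases b) (auto simp: N_eq)

lemma finite_N: "finite N"
  by (simp add: N_eq finite_path)

lemma not_in_other: "i \<in> path b \<Longrightarrow> i \<notin> path (\<not> b)"
  using disjoint by (cases b) auto

lemma in_other_iff: "i \<in> N \<Longrightarrow> i \<in> path (\<not> b) \<longleftrightarrow> i \<notin> path b"
  using disjoint by (cases b) (auto simp: N_eq)

lemma type_upd: "\<theta> \<in> \<Theta> \<Longrightarrow> i \<in> N \<Longrightarrow> x \<in> {L, M, H} \<Longrightarrow> \<theta>(i := x) \<in> \<Theta>"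
  unfolding \<Theta>_def by (auto simp: PiE_iff extensional_def)

lemma type_value: "\<theta> \<in> \<Theta> \<Longrightarrow> i \<in> N \<Longrightarrow> \<theta> i \<in> {L, M, H}"
  unfolding \<Theta>_def by (rule PiE_mem)

section \<open>Path selection after one changed report\<close>

lemma sel_eqI:
  assumes "\<theta> \<in> \<Theta>" "sum \<theta> (path b) < sum \<theta> (path (\<not> b))"
  shows "sel \<theta> = b"
  using sel_min[OF assms(1), of b] assms(2) by (cases "sel \<theta>"; cases b) auto

lemma sum_upd_same: "i \<in> path b \<Longrightarrow> sum (\<theta>(i := x)) (path b) = sum \<theta> (path b) - \<theta> i + x"
  for x :: real
  by (simp add: sum.remove[OF finite_path, of i])

lemma sum_upd_other: "i \<in> path b \<Longrightarrow> sum (\<theta>(i := x)) (path (\<not> b)) = sum \<theta> (path (\<not> b))"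
  using not_in_other[of i b] by (intro sum.cong) auto

text \<open>A strict drop turns even a tie into a strict win, so tie-breaking no longer
  matters.\<close>

lemma sel_lower:
  assumes "\<theta> \<in> \<Theta>" "i \<in> path b" "x \<in> {L, M, H}" "x < \<theta> i"
    and "sum \<theta> (path b) \<le> sum \<theta> (path (\<not> b))"
  shows "sel (\<theta>(i := x)) = b"
proof (rule sel_eqI)
  show "\<theta>(i := x) \<in> \<Theta>"
    using assms path_subset type_upd by blast
  show "sum (\<theta>(i := x)) (path b) < sum (\<theta>(i := x)) (path (\<not> b))"
    using assms by (simp add: sum_upd_same sum_upd_other del: fun_upd_apply)
qed

lemma sel_raise:
  assumes "\<theta> \<in> \<Theta>" "i \<in> path b" "x \<in> {L, M, H}" "\<theta> i < x"
    and "sum \<theta> (path (\<not> b)) \<le> sum \<theta> (path b)"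
  shows "sel (\<theta>(i := x)) = (\<not> b)"
proof (rule sel_eqI)
  show "\<theta>(i := x) \<in> \<Theta>"
    using assms path_subset type_upd by blast
  show "sum (\<theta>(i := x)) (path (\<not> b)) < sum (\<theta>(i := x)) (path (\<not> \<not> b))"
    using assms by (simp add: sum_upd_same sum_upd_other del: fun_upd_apply)
qed

section \<open>Payments depend only on the selected path\<close>

lemma pay_upd:
  assumes \<theta>: "\<theta> \<in> \<Theta>" and i: "i \<in> N" and x: "x \<in> {L, M, H}" and j: "j \<in> N"
    and sel: "sel (\<theta>(i := x)) = sel \<theta>"
  shows "p (\<theta>(i := x)) j = p \<theta> j"
proof -
  let ?\<theta>' = "\<theta>(i := x)"
  have \<theta>': "?\<theta>' \<in> \<Theta>" using \<theta> i x by (rule type_upd)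
  have undo: "?\<theta>'(i := \<theta> i) = \<theta>" by simp
  have same: "A ?\<theta>' k = A \<theta> k" if "k \<in> N" for k
    using alloc[OF \<theta> that] alloc[OF \<theta>' that] sel by simp
  \<comment> \<open>The allocation is unchanged, so costs cancel; truthfulness for the deviation and
    for its reversal gives both inequalities.\<close>
  have own: "p ?\<theta>' i = p \<theta> i"
    using truthful[OF \<theta> i x] truthful[OF \<theta>' i type_value[OF \<theta> i]] same[OF i]
    unfolding undo by simp
  show ?thesis
  proof (cases "i = j")
    case True
    with own show ?thesis by simp
  next
    case False
    \<comment> \<open>Likewise the pair constraint in both directions fixes the sum of the two
      payments, and \<open>own\<close> removes the share of \<open>i\<close>.\<close>
    with own show ?thesis
      using unbribable[OF \<theta> i j False x] unbribable[OF \<theta>' i j False type_value[OF \<theta> i]]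
        same[OF i] same[OF j]
      unfolding undo by simp
  qed
qed

text \<open>The profile most favourable to path \<open>b\<close>; it represents all profiles that
  select \<open>b\<close>.\<close>

definition base :: "bool \<Rightarrow> 'a \<Rightarrow> real" where
  "base b = (\<lambda>i\<in>N. if i \<in> path b then L else H)"

lemma base_type: "i \<in> N \<Longrightarrow> base b i \<in> {L, M, H}"
  by (simp add: base_def)

text \<open>Moving the reports one by one towards \<open>base b\<close> only ever makes path \<open>b\<close> more attractive.\<close>

lemma pay_region:
  assumes \<theta>: "\<theta> \<in> \<Theta>" and j: "j \<in> N"
  shows "p \<theta> j = p (base (sel \<theta>)) j"
proof -
  let ?b = "sel \<theta>"
  \<comment> \<open>\<open>F\<close> collects the agents already moved to \<open>base ?b\<close>.
    The selection is carried through the induction because \<open>pay_upd\<close> needs it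
    fixed.\<close>
  have "override_on \<theta> (base ?b) F \<in> \<Theta> \<and> sel (override_on \<theta> (base ?b) F) = ?b \<and>
      p (override_on \<theta> (base ?b) F) j = p \<theta> j" if "finite F" "F \<subseteq> N" for F
    using that
  proof (induction F)
    case empty
    show ?case using \<theta> by simp
  next
    case (insert i F)
    define \<phi> where "\<phi> = override_on \<theta> (base ?b) F"
    have \<phi>: "\<phi> \<in> \<Theta>" "sel \<phi> = ?b" "p \<phi> j = p \<theta> j" and i: "i \<in> N"
      using insert by (auto simp: \<phi>_def)
    have upd: "override_on \<theta> (base ?b) (insert i F) = \<phi>(i := base ?b i)"
      by (simp add: \<phi>_def override_on_insert)
    have le: "sum \<phi> (path ?b) \<le> sum \<phi> (path (\<not> ?b))"
      using sel_min[OF \<phi>(1), of "\<not> ?b"] \<phi>(2) by simp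
    have "sel (\<phi>(i := base ?b i)) = ?b"
    proof (cases "\<phi> i = base ?b i")
      case True
      then show ?thesis using \<phi>(2) by (metis fun_upd_triv)
    next
      case ne: False
      show ?thesis
      proof (cases "i \<in> path ?b")
        case True
        have "base ?b i < \<phi> i"
          using ne type_value[OF \<phi>(1) i] True i LM MH by (auto simp: base_def)
        then show ?thesis
          using \<phi>(1) True base_type[OF i] le by (intro sel_lower)
      next
        case False
        have "\<phi> i < base ?b i"
          using ne type_value[OF \<phi>(1) i] False i LM MH by (auto simp: base_def)
        moreover have "i \<in> path (\<not> ?b)"
          using False i by (simp add: in_other_iff)
        ultimately show ?thesis
          using sel_raise[where b = "\<not> ?b", OF \<phi>(1) _ base_type[OF i]] le by simp
      qed
    qed
    then show ?case
      using pay_upd[OF \<phi>(1) i base_type[OF i] j] type_upd[OF \<phi>(1) i base_type[OF i]] \<phi>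
      unfolding upd by (simp del: fun_upd_apply)
  qed
  from this[OF finite_N subset_refl]
  have "p (override_on \<theta> (base ?b) N) j = p \<theta> j" by simp
  moreover have "override_on \<theta> (base ?b) N = base ?b"
    using \<theta> by (auto simp: override_on_def base_def \<Theta>_def PiE_iff extensional_def fun_eq_iff)
  ultimately show ?thesis by simp
qed

section \<open>Incentive bounds on the gaps\<close>

definition gap :: "bool \<Rightarrow> 'a \<Rightarrow> real" where
  "gap b i = p (base b) i - p (base (\<not> b)) i"

text \<open>The first bound is truthfulness at \<open>\<theta>\<close>, where \<open>i\<close>
  works. The second uses the reverse deviation: at the losing profile the true costs of the pair are
  \<open>x\<close> and \<open>\<theta> j\<close>, and winning must not pay for them jointly.\<close>

lemma gap_bounds:
  assumes \<theta>: "\<theta> \<in> \<Theta>" and i: "i \<in> path b" and x: "x \<in> {L, M, H}"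
    and sel: "sel \<theta> = b" "sel (\<theta>(i := x)) = (\<not> b)"
  shows gap_ge: "\<theta> i \<le> gap b i"
    and gap_pair_le: "j \<in> path b \<Longrightarrow> i \<noteq> j \<Longrightarrow> gap b i + gap b j \<le> x + \<theta> j"
proof -
  let ?\<theta>' = "\<theta>(i := x)"
  have iN: "i \<in> N" using i by (rule path_subset)
  have \<theta>': "?\<theta>' \<in> \<Theta>" using \<theta> iN x by (rule type_upd)
  have undo: "?\<theta>'(i := \<theta> i) = \<theta>" by simp
  have A: "A \<theta> k = 1" "A ?\<theta>' k = 0" if "k \<in> path b" for k
    using alloc[OF \<theta>, of k] alloc[OF \<theta>', of k] sel that not_in_other[OF that] path_subset
    by auto
  have gap: "gap b k = p \<theta> k - p ?\<theta>' k" if "k \<in> path b" for k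
    using pay_region[OF \<theta>, of k] pay_region[OF \<theta>', of k] sel that path_subset
    by (simp add: gap_def)
  show "\<theta> i \<le> gap b i"
    using truthful[OF \<theta> iN x] by (simp add: A[OF i] gap[OF i])
  show "gap b i + gap b j \<le> x + \<theta> j" if j: "j \<in> path b" and ne: "i \<noteq> j"
    using unbribable[OF \<theta>' iN path_subset[OF j] ne type_value[OF \<theta> iN]] ne
    unfolding undo by (simp add: A[OF i] A[OF j] gap[OF i] gap[OF j])
qed

section \<open>Tied profiles and the bound on path length\<close>

definition tie :: "'a \<Rightarrow> 'a \<Rightarrow> real \<Rightarrow> 'a \<Rightarrow> real" where
  "tie j l v = (\<lambda>x\<in>N. if x = j \<or> x = l then v else M)"

lemma tie_type: "v \<in> {L, M, H} \<Longrightarrow> tie j l v \<in> \<Theta>"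
  by (auto simp: tie_def \<Theta>_def)

text \<open>Each path contains exactly one of \<open>j\<close>, \<open>l\<close> and both have the
  same size, so the cost is independent of \<open>c\<close>: a genuine tie.\<close>

lemma sum_tie:
  assumes "j \<in> path b" "l \<in> path (\<not> b)"
  shows "sum (tie j l v) (path c) = v + (real (card (path True)) - 1) * M"
proof -
  define k where "k = (if c = b then j else l)"
  have k: "k \<in> path c"
    using assms by (cases b; cases c) (auto simp: k_def)
  have "tie j l v x = M" if "x \<in> path c - {k}" for x
    using that assms path_subset[of x c] disjoint
    by (cases b; cases c) (auto simp: tie_def k_def)
  then have "sum (tie j l v) (path c - {k}) = real (card (path c - {k})) * M"
    by simp
  moreover have "tie j l v k = v"
    using path_subset[OF k] by (auto simp: tie_def k_def)
  moreover have "real (card (path c - {k})) = real (card (path True)) - 1"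
  proof -
    have "card (path c) = card (path True)"
      by (cases c) (auto simp: card_path)
    moreover have "card (path c) > 0"
      using k finite_path card_gt_0_iff by blast
    ultimately show ?thesis
      using k by (simp add: of_nat_diff)
  qed
  ultimately show ?thesis
    using k by (simp add: sum.remove[OF finite_path])
qed

lemma tie_values:
  assumes "i \<in> path b" "j \<in> path b" "l \<in> path (\<not> b)" "i \<noteq> j"
  shows "tie j l v i = M" "tie j l v j = v"
  using assms not_in_other[OF assms(1)] path_subset by (auto simp: tie_def)

lemma low_gap_unique:
  assumes i: "i \<in> path b" and j: "j \<in> path b" and ne: "i \<noteq> j" and l: "l \<in> path (\<not> b)"
  shows "M \<le> gap b i \<or> M \<le> gap b j"
proof -
  define \<theta> where "\<theta> = tie j l H"
  have \<theta>: "\<theta> \<in> \<Theta>" by (simp add: \<theta>_def tie_type)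
  have sums: "sum \<theta> (path b) = sum \<theta> (path (\<not> b))"
    unfolding \<theta>_def using j l by (simp add: sum_tie)
  have vals: "\<theta> i = M" "\<theta> j = H"
    unfolding \<theta>_def using tie_values[OF i j l ne] by simp_all
  show ?thesis
  proof (cases "sel \<theta> = b")
    case True
    \<comment> \<open>Path \<open>b\<close> wins the tie, and \<open>i\<close>, of cost
      \<open>M\<close>, could make it lose.\<close>
    moreover have "sel (\<theta>(i := H)) = (\<not> b)"
      using \<theta> i sums vals MH by (intro sel_raise) auto
    ultimately show ?thesis
      using gap_ge[OF \<theta> i, of H] vals by simp
  next
    case False
    \<comment> \<open>Path \<open>b\<close> loses the tie. Once \<open>j\<close> has cost
      \<open>M\<close> it wins, and reporting \<open>H\<close> would bring the lost tie
      back.\<close>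
    have low: "sel (\<theta>(j := M)) = b"
      using \<theta> j sums vals MH by (intro sel_lower) auto
    have undo: "\<theta>(j := M, j := H) = \<theta>" using vals by auto
    have "\<theta>(j := M) \<in> \<Theta>"
      using \<theta> path_subset[OF j] by (intro type_upd) auto
    then have "M \<le> gap b j"
      using gap_ge[of "\<theta>(j := M)" j b H] False low j undo by simp
    then show ?thesis by simp
  qed
qed

text \<open>Of at least three agents on a path, at most one has a gap below
  \<open>M\<close>.\<close>

lemma two_high_gaps:
  assumes "card (path True) \<ge> 3"
  obtains i j where "i \<in> path b" "j \<in> path b" "i \<noteq> j" "M \<le> gap b i" "M \<le> gap b j"
proof -
  have card: "card (path c) \<ge> 3" for c
    using assms card_path by (cases c) auto
  then obtain l where l: "l \<in> path (\<not> b)"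
    by (metis all_not_in_conv card.empty not_numeral_le_zero)
  define F where "F = {i \<in> path b. gap b i < M}"
  have "card F \<le> Suc 0"
    unfolding F_def using low_gap_unique[OF _ _ _ l] finite_path
    by (subst card_le_Suc0_iff_eq) (auto, fastforce)
  moreover have "card (path b - F) = card (path b) - card F"
    by (rule card_Diff_subset) (auto simp: F_def finite_path)
  ultimately have "\<not> card (path b - F) \<le> Suc 0"
    using card[of b] by linarith
  then obtain i j where "i \<in> path b - F" "j \<in> path b - F" "i \<noteq> j"
    using finite_path by (subst (asm) card_le_Suc0_iff_eq) auto
  then show thesis
    by (intro that[of i j]) (auto simp: F_def)
qed

lemma losing_gaps:
  assumes i: "i \<in> path b" and j: "j \<in> path b" and ne: "i \<noteq> j" and l: "l \<in> path (\<not> b)"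
    and sel: "sel (tie j l L) = (\<not> b)"
  shows "gap b i + gap b j \<le> M + L"
proof -
  define \<theta> where "\<theta> = tie j l L"
  have \<theta>: "\<theta> \<in> \<Theta>" by (simp add: \<theta>_def tie_type)
  have sums: "sum \<theta> (path b) = sum \<theta> (path (\<not> b))"
    unfolding \<theta>_def using j l by (simp add: sum_tie)
  have vals: "\<theta> i = M" "\<theta> j = L"
    unfolding \<theta>_def using tie_values[OF i j l ne] by simp_all
  have low: "sel (\<theta>(i := L)) = b"
    using \<theta> i sums vals LM by (intro sel_lower) auto
  have undo: "\<theta>(i := L, i := M) = \<theta>" using vals by auto
  have "\<theta>(i := L) \<in> \<Theta>"
    using \<theta> path_subset[OF i] by (intro type_upd) auto
  \<comment> \<open>The winning profile is the one after the bribe; the deviation back to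
    \<open>M\<close> restores the lost tie.\<close>
  then have "gap b i + gap b j \<le> M + (\<theta>(i := L)) j"
    using gap_pair_le[of "\<theta>(i := L)" i b M j] low sel i j ne undo by (simp add: \<theta>_def)
  then show ?thesis using vals ne by simp
qed

lemma short_paths: "card (path True) < 3"
proof (rule ccontr)
  assume "\<not> card (path True) < 3"
  then have card: "card (path True) \<ge> 3" by simp
  obtain i j where ij: "i \<in> path True" "j \<in> path True" "i \<noteq> j"
      "M \<le> gap True i" "M \<le> gap True j"
    using two_high_gaps[OF card] by blast
  obtain k l where kl: "k \<in> path False" "l \<in> path False" "k \<noteq> l"
      "M \<le> gap False k" "M \<le> gap False l"
    using two_high_gaps[OF card] by blast
  \<comment> \<open>The same tie must serve both paths, with \<open>j\<close> and \<open>l\<close>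
    in exchanged roles.\<close>
  have comm: "tie l j L = tie j l L"
    by (auto simp: tie_def fun_eq_iff)
  show False
  \<comment> \<open>Whichever path loses, its two high gaps give
    \<open>2 * M \<le> M + L\<close>.\<close>
  proof (cases "sel (tie j l L)")
    case True
    then show False
      using losing_gaps[of k False l j] ij kl LM comm by simp
  next
    case False
    then show False
      using losing_gaps[of i True j l] ij kl LM by simp
  qed
qed

end

section \<open>The hexagon as a two-path network\<close>

definition hexagon :: "nat network" where
  "hexagon = \<lparr>num_agents = 6, verts = {0..5}, edge = (\<lambda>i. {i - 1, i mod 6}), source = 0, sink = 3\<rparr>"

definition hexagon_path :: "bool \<Rightarrow> nat list" where
  "hexagon_path b = (if b then [0, 1, 2, 3] else [0, 5, 4, 3])"

text \<open>Agent \<open>i\<close> owns the edge from \<open>i - 1\<close> to \<open>i\<close>, with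
  vertex 6 read as 0, so the path through 5 and 4 uses edges 6, 5, 4.\<close>

definition hexagon_agents :: "bool \<Rightarrow> nat set" where
  "hexagon_agents b = (if b then {1, 2, 3} else {4, 5, 6})"

lemma agents_hexagon: "agents hexagon = {1, 2, 3, 4, 5, 6}"
  by (auto simp: agents_def hexagon_def)

lemma edges_hexagon: "edge hexagon ` agents hexagon = {{0,1},{1,2},{2,3},{3,4},{4,5},{5,0}}"
  by (simp add: agents_hexagon) (simp add: hexagon_def)

lemma path_edges_single: "path_edges [x] = {}"
  by (simp add: path_edges_def)

lemma path_edges_Cons: "path_edges (x # y # zs) = insert {x, y} (path_edges (y # zs))"
proof -
  have "(\<exists>k. R k) \<longleftrightarrow> R 0 \<or> (\<exists>k. R (Suc k))" for R :: "nat \<Rightarrow> bool"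
    by (metis not0_implies_Suc)
  from this[of "\<lambda>k. e = {(x # y # zs) ! k, (x # y # zs) ! Suc k} \<and> Suc k < length (x # y # zs)" for e]
  show ?thesis
    unfolding path_edges_def by (intro set_eqI) simp
qed

lemma st_path_successively:
  "st_path G xs \<longleftrightarrow> xs \<noteq> [] \<and> distinct xs \<and> set xs \<subseteq> verts G \<and> hd xs = source G \<and>
     last xs = sink G \<and> successively (\<lambda>x y. {x, y} \<in> edge G ` agents G) xs"
  by (simp add: st_path_def successively_conv_nth)

text \<open>The first step from 0 decides the path: distinctness forbids turning back, and ending at
  3 forbids passing it.\<close>

lemma st_path_hexagon: "st_path hexagon xs \<longleftrightarrow> (\<exists>b. xs = hexagon_path b)"
proof
  assume "\<exists>b. xs = hexagon_path b"
  then show "st_path hexagon xs"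
    unfolding st_path_successively edges_hexagon
    by (auto simp: hexagon_path_def hexagon_def doubleton_eq_iff split: if_splits)
next
  assume xs: "st_path hexagon xs"
  have "xs = [0, 1, 2, 3] \<or> xs = [0, 5, 4, 3]"
    using xs unfolding st_path_successively edges_hexagon
    by (cases xs rule: list.exhaust; simp add: hexagon_def)
       (auto simp: neq_Nil_conv successively_Cons doubleton_eq_iff split: if_splits)
  then show "\<exists>b. xs = hexagon_path b"
    by (metis hexagon_path_def)
qed

lemma is_network_hexagon: "is_network hexagon"
proof -
  have "inj_on (edge hexagon) (agents hexagon)"
    unfolding agents_hexagon by (simp add: hexagon_def doubleton_eq_iff)
  moreover have "\<forall>i\<in>agents hexagon. edge hexagon i \<subseteq> verts hexagon \<and> card (edge hexagon i) = 2"
    unfolding agents_hexagon by (simp add: hexagon_def)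
  moreover have "\<exists>xs. st_path hexagon xs"
    using st_path_hexagon by blast
  ultimately show ?thesis
    by (simp add: is_network_def) (simp add: hexagon_def)
qed

lemma path_allocation_hexagon:
  "i \<in> agents hexagon \<Longrightarrow>
    path_allocation hexagon (hexagon_path b) i = of_bool (i \<in> hexagon_agents b)"
  unfolding path_allocation_def agents_hexagon
  by (auto simp: hexagon_def hexagon_path_def hexagon_agents_def path_edges_Cons
      path_edges_single doubleton_eq_iff)

lemma total_cost_hexagon:
  "total_cost (agents hexagon) (path_allocation hexagon (hexagon_path b)) \<theta>
     = sum \<theta> (hexagon_agents b)"
proof -
  have "total_cost (agents hexagon) (path_allocation hexagon (hexagon_path b)) \<theta>
      = (\<Sum>i\<in>agents hexagon. of_bool (i \<in> hexagon_agents b) * \<theta> i)"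
    by (simp add: total_cost_def path_allocation_hexagon)
  also have "\<dots> = sum \<theta> (hexagon_agents b)"
    by (simp add: agents_hexagon hexagon_agents_def)
  finally show ?thesis .
qed

lemma hexagon_not_bribeproof:
  fixes L M H :: real
  assumes "L < M" and "M < H"
    and A: "A \<in> Pi\<^sub>E (agents hexagon) (\<lambda>_. {L, M, H}) \<rightarrow> feasible hexagon"
    and min: "minimizes_cost hexagon (\<lambda>_. {L, M, H}) A"
  shows "\<not> bribeproof (agents hexagon) (\<lambda>_. {L, M, H}) A p"
proof
  assume bp: "bribeproof (agents hexagon) (\<lambda>_. {L, M, H}) A p"
  let ?N = "agents hexagon" and ?\<Theta> = "Pi\<^sub>E (agents hexagon) (\<lambda>_. {L, M, H})"
  have "\<exists>b. A \<theta> = path_allocation hexagon (hexagon_path b)" if "\<theta> \<in> ?\<Theta>" for \<theta>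
    using funcset_mem[OF A that] by (auto simp: feasible_def st_path_hexagon)
  then obtain sel where
    sel: "\<And>\<theta>. \<theta> \<in> ?\<Theta> \<Longrightarrow> A \<theta> = path_allocation hexagon (hexagon_path (sel \<theta>))"
    by metis
  interpret two_path_mechanism ?N hexagon_agents L M H A p sel ?\<Theta>
  \<comment> \<open>Cases 7 to 10 are \<open>alloc\<close>, \<open>sel_min\<close>,
    \<open>truthful\<close> and \<open>unbribable\<close>.\<close>
  proof (unfold_locales, goal_cases)
    case (7 \<theta> i)
    then show ?case by (simp add: sel path_allocation_hexagon)
  next
    case (8 \<theta> b)
    have "path_allocation hexagon (hexagon_path b) \<in> feasible hexagon"
      by (auto simp: feasible_def st_path_hexagon)
    then show ?case
      using min 8 sel[OF 8] unfolding minimizes_cost_def by (metis total_cost_hexagon)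
  next
    case (9 \<theta> i x)
    then show ?case using bp unfolding bribeproof_def utility_def by blast
  next
    case (10 \<theta> i j x)
    then show ?case using bp unfolding bribeproof_def utility_def by blast
  qed (use assms in \<open>auto simp: agents_hexagon hexagon_agents_def\<close>)
  \<comment> \<open>Each path of the hexagon has exactly three edges.\<close>
  show False
    using short_paths by (simp add: hexagon_agents_def)
qed

theorem theorem16:
  fixes L M H :: real
  assumes "L < M" and "M < H"
  shows "\<exists>G :: nat network. is_network G \<and>
           (\<nexists>A p. A \<in> Pi\<^sub>E (agents G) (\<lambda>_. {L, M, H}) \<rightarrow> feasible G \<and>
                  minimizes_cost G (\<lambda>_. {L, M, H}) A \<and>
                  bribeproof (agents G) (\<lambda>_. {L, M, H}) A p)"
  using is_network_hexagon hexagon_not_bribeproof[OF assms] by blast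

end
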